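(* The category $\mathit{SDTop}$ of saturated d-spaces is complete as a subcategory of $\mathit{DTop}$: for every small diagram $D\colon J\to\mathit{SDTop}$, the limit of $D$ computed in $\mathit{DTop}$ is a saturated d-space, and hence is a limit of $D$ in $\mathit{SDTop}$.
   Context: Let $I=[0,1]$. A d-space is a pair $(X,dX)$ of a topological space $X$ and a set $dX$ of continuous maps $I\to X$ (called directed paths) such that constant paths are in $dX$, $dX$ is stable under concatenation, and $dX$ is stable under precomposition with continuous non-decreasing maps $I\to I$. A morphism $(X,dX)\to(Y,dY)$ is a continuous map $f\colon X\to Y$ with $f\circ p\in dY$ for all $p\in dX$. This gives the category $\mathit{DTop}$, which is known to be complete. Let $\mathbb I$ be the d-space with underlying space $I$ whose directed paths are the non-decreasing continuous maps $I\to I$. An open subset $U\subseteq X$ of a d-space inherits a d-space structure: its directed paths are the directed paths of $X$ with image in $U$. A directed function on $U$ is a morphism of d-spaces $U\to\mathbb I$. A path (continuous map) $c\colon I\to X$ is weakly directed if for every open $U\subseteq X$ and every directed function $f\colon U\to I$ on $U$, the map $f\circ c\colon c^{-1}(U)\to I$ is locally non-decreasing (every point of $c^{-1}(U)$ has a neighbourhood in $c^{-1}(U)$ on which it is non-decreasing). The set of weakly directed paths is denoted $\hat dX$. A d-space $X$ is saturated if $\hat dX=dX$. $\mathit{SDTop}$ is the full subcategory of $\mathit{DTop}$ on saturated d-spaces. *)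

theory Defs
  imports "HOL-Analysis.Analysis"
begin

abbreviation unit_I :: "real set"
  where "unit_I \<equiv> {0..1}"

text \<open>Maps are represented by functions that are \<^const>\<open>undefined\<close> outside their domain
  (\<^const>\<open>extensional\<close>), so that equality of HOL functions is equality of maps. In particular a path
  is a function on the reals that carries information on \<open>[0,1]\<close> only, and maps are composed with
  \<^const>\<open>compose\<close>.\<close>

definition paths :: "'a topology \<Rightarrow> (real \<Rightarrow> 'a) set"
  where "paths X = {p \<in> extensional unit_I. pathin X p}"

definition concat_path :: "(real \<Rightarrow> 'a) \<Rightarrow> (real \<Rightarrow> 'a) \<Rightarrow> real \<Rightarrow> 'a"
  where "concat_path p q = (\<lambda>t\<in>unit_I. if t \<le> 1/2 then p (2 * t) else q (2 * t - 1))"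

definition nondecreasing_paths :: "(real \<Rightarrow> real) set"
  where "nondecreasing_paths = {p \<in> paths (top_of_set unit_I). mono_on unit_I p}"

record 'a dspace =
  dtop :: "'a topology"
  dpaths :: "(real \<Rightarrow> 'a) set"

definition is_dspace :: "'a dspace \<Rightarrow> bool"
  where "is_dspace X \<longleftrightarrow>
    dpaths X \<subseteq> paths (dtop X) \<and>
    (\<forall>x \<in> topspace (dtop X). (\<lambda>t\<in>unit_I. x) \<in> dpaths X) \<and>
    (\<forall>p \<in> dpaths X. \<forall>q \<in> dpaths X. p 1 = q 0 \<longrightarrow> concat_path p q \<in> dpaths X) \<and>
    (\<forall>p \<in> dpaths X. \<forall>\<phi> \<in> nondecreasing_paths. compose unit_I p \<phi> \<in> dpaths X)"

definition dmaps :: "'a dspace \<Rightarrow> 'b dspace \<Rightarrow> ('a \<Rightarrow> 'b) set"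
  where "dmaps X Y = {f \<in> extensional (topspace (dtop X)).
    continuous_map (dtop X) (dtop Y) f \<and> (\<forall>p \<in> dpaths X. compose unit_I f p \<in> dpaths Y)}"

definition directed_interval :: "real dspace"
  where "directed_interval = \<lparr>dtop = top_of_set unit_I, dpaths = nondecreasing_paths\<rparr>"

definition sub_dspace :: "'a dspace \<Rightarrow> 'a set \<Rightarrow> 'a dspace"
  where "sub_dspace X U =
    \<lparr>dtop = subtopology (dtop X) U, dpaths = {p \<in> dpaths X. p ` unit_I \<subseteq> U}\<rparr>"

definition directed_functions :: "'a dspace \<Rightarrow> 'a set \<Rightarrow> ('a \<Rightarrow> real) set"
  where "directed_functions X U = dmaps (sub_dspace X U) directed_interval"

definition locally_nondecreasing_on :: "real set \<Rightarrow> (real \<Rightarrow> real) \<Rightarrow> bool"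
  where "locally_nondecreasing_on A g \<longleftrightarrow>
    (\<forall>t \<in> A. \<exists>N. openin (top_of_set A) N \<and> t \<in> N \<and> mono_on N g)"

definition weakly_directed_paths :: "'a dspace \<Rightarrow> (real \<Rightarrow> 'a) set"
  where "weakly_directed_paths X = {c \<in> paths (dtop X).
    \<forall>U f. openin (dtop X) U \<longrightarrow> f \<in> directed_functions X U \<longrightarrow>
      locally_nondecreasing_on {t \<in> unit_I. c t \<in> U} (f \<circ> c)}"

definition saturated :: "'a dspace \<Rightarrow> bool"
  where "saturated X \<longleftrightarrow> is_dspace X \<and> weakly_directed_paths X = dpaths X"

record ('o, 'm) cat =
  Ob :: "'o set"
  Mor :: "'m set"
  Src :: "'m \<Rightarrow> 'o"
  Tgt :: "'m \<Rightarrow> 'o"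
  Idn :: "'o \<Rightarrow> 'm"
  Cmp :: "'m \<Rightarrow> 'm \<Rightarrow> 'm"

text \<open>\<open>Cmp J g f\<close> is the composite ``\<open>g\<close> after \<open>f\<close>''.\<close>

definition is_category :: "('o, 'm) cat \<Rightarrow> bool"
  where "is_category J \<longleftrightarrow>
    (\<forall>m \<in> Mor J. Src J m \<in> Ob J \<and> Tgt J m \<in> Ob J) \<and>
    (\<forall>j \<in> Ob J. Idn J j \<in> Mor J \<and> Src J (Idn J j) = j \<and> Tgt J (Idn J j) = j) \<and>
    (\<forall>f \<in> Mor J. \<forall>g \<in> Mor J. Tgt J f = Src J g \<longrightarrow>
      Cmp J g f \<in> Mor J \<and> Src J (Cmp J g f) = Src J f \<and> Tgt J (Cmp J g f) = Tgt J g) \<and>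
    (\<forall>f \<in> Mor J. Cmp J f (Idn J (Src J f)) = f \<and> Cmp J (Idn J (Tgt J f)) f = f) \<and>
    (\<forall>f \<in> Mor J. \<forall>g \<in> Mor J. \<forall>h \<in> Mor J. Tgt J f = Src J g \<longrightarrow> Tgt J g = Src J h \<longrightarrow>
      Cmp J h (Cmp J g f) = Cmp J (Cmp J h g) f)"

text \<open>Functors \<open>J \<rightarrow> DTop\<close>, given by an object part \<open>D\<close> and a morphism part \<open>Dm\<close>. Taking all the
  spaces \<open>D j\<close> on one type \<open>'a\<close> is no restriction: a family of sets indexed by \<open>Ob J\<close> embeds
  into its disjoint union.\<close>

definition DTop_diagram ::
    "('o, 'm) cat \<Rightarrow> ('o \<Rightarrow> 'a dspace) \<Rightarrow> ('m \<Rightarrow> 'a \<Rightarrow> 'a) \<Rightarrow> bool"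
  where "DTop_diagram J D Dm \<longleftrightarrow>
    (\<forall>j \<in> Ob J. is_dspace (D j)) \<and>
    (\<forall>m \<in> Mor J. Dm m \<in> dmaps (D (Src J m)) (D (Tgt J m))) \<and>
    (\<forall>j \<in> Ob J. Dm (Idn J j) = (\<lambda>x \<in> topspace (dtop (D j)). x)) \<and>
    (\<forall>f \<in> Mor J. \<forall>g \<in> Mor J. Tgt J f = Src J g \<longrightarrow>
      Dm (Cmp J g f) = compose (topspace (dtop (D (Src J f)))) (Dm g) (Dm f))"

text \<open>\<open>SDTop\<close> is a full subcategory of \<open>DTop\<close>, so only the objects are constrained.\<close>

definition SDTop_diagram ::
    "('o, 'm) cat \<Rightarrow> ('o \<Rightarrow> 'a dspace) \<Rightarrow> ('m \<Rightarrow> 'a \<Rightarrow> 'a) \<Rightarrow> bool"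
  where "SDTop_diagram J D Dm \<longleftrightarrow> DTop_diagram J D Dm \<and> (\<forall>j \<in> Ob J. saturated (D j))"

definition cone ::
    "('o, 'm) cat \<Rightarrow> ('o \<Rightarrow> 'a dspace) \<Rightarrow> ('m \<Rightarrow> 'a \<Rightarrow> 'a) \<Rightarrow>
     'l dspace \<Rightarrow> ('o \<Rightarrow> 'l \<Rightarrow> 'a) \<Rightarrow> bool"
  where "cone J D Dm L \<pi> \<longleftrightarrow>
    (\<forall>j \<in> Ob J. \<pi> j \<in> dmaps L (D j)) \<and>
    (\<forall>m \<in> Mor J. compose (topspace (dtop L)) (Dm m) (\<pi> (Src J m)) = \<pi> (Tgt J m))"

text \<open>The universal property of a cone, tested on the d-spaces on the type \<open>'c\<close> that satisfy \<open>K\<close>.\<close>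

definition universal_for ::
    "('c dspace \<Rightarrow> bool) \<Rightarrow> ('o, 'm) cat \<Rightarrow> ('o \<Rightarrow> 'a dspace) \<Rightarrow> ('m \<Rightarrow> 'a \<Rightarrow> 'a) \<Rightarrow>
     'l dspace \<Rightarrow> ('o \<Rightarrow> 'l \<Rightarrow> 'a) \<Rightarrow> bool"
  where "universal_for K J D Dm L \<pi> \<longleftrightarrow>
    (\<forall>Z \<rho>. K Z \<longrightarrow> cone J D Dm Z \<rho> \<longrightarrow>
      (\<exists>!h. h \<in> dmaps Z L \<and> (\<forall>j \<in> Ob J. compose (topspace (dtop Z)) (\<pi> j) h = \<rho> j)))"

text \<open>HOL cannot quantify over types inside a formula, so the type \<open>'c\<close> of the test objects is an
  explicit argument. A theorem that concludes these predicates for a free type variable \<open>'c\<close> asserts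
  the universal property with respect to all d-spaces. As a hypothesis on \<open>L :: 'l dspace\<close>, taking
  \<open>'c = 'l\<close> only makes it weaker than the universal property with respect to all d-spaces.\<close>

definition DTop_limit ::
    "'c itself \<Rightarrow> ('o, 'm) cat \<Rightarrow> ('o \<Rightarrow> 'a dspace) \<Rightarrow> ('m \<Rightarrow> 'a \<Rightarrow> 'a) \<Rightarrow>
     'l dspace \<Rightarrow> ('o \<Rightarrow> 'l \<Rightarrow> 'a) \<Rightarrow> bool"
  where "DTop_limit T J D Dm L \<pi> \<longleftrightarrow>
    is_dspace L \<and> cone J D Dm L \<pi> \<and> universal_for (is_dspace :: 'c dspace \<Rightarrow> bool) J D Dm L \<pi>"

definition SDTop_limit ::
    "'c itself \<Rightarrow> ('o, 'm) cat \<Rightarrow> ('o \<Rightarrow> 'a dspace) \<Rightarrow> ('m \<Rightarrow> 'a \<Rightarrow> 'a) \<Rightarrow>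
     'l dspace \<Rightarrow> ('o \<Rightarrow> 'l \<Rightarrow> 'a) \<Rightarrow> bool"
  where "SDTop_limit T J D Dm L \<pi> \<longleftrightarrow>
    saturated L \<and> cone J D Dm L \<pi> \<and> universal_for (saturated :: 'c dspace \<Rightarrow> bool) J D Dm L \<pi>"

text \<open>The standard construction of limits in \<open>DTop\<close>: compatible families, topologised as a subspace
  of the product, with the paths whose components are all directed.\<close>

definition compatible_families ::
    "('o, 'm) cat \<Rightarrow> ('o \<Rightarrow> 'a dspace) \<Rightarrow> ('m \<Rightarrow> 'a \<Rightarrow> 'a) \<Rightarrow> ('o \<Rightarrow> 'a) set"
  where "compatible_families J D Dm =
    {x \<in> (\<Pi>\<^sub>E j\<in>Ob J. topspace (dtop (D j))). \<forall>m \<in> Mor J. Dm m (x (Src J m)) = x (Tgt J m)}"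

definition DTop_lim ::
    "('o, 'm) cat \<Rightarrow> ('o \<Rightarrow> 'a dspace) \<Rightarrow> ('m \<Rightarrow> 'a \<Rightarrow> 'a) \<Rightarrow> ('o \<Rightarrow> 'a) dspace"
  where "DTop_lim J D Dm =
    (let T = subtopology (product_topology (\<lambda>j. dtop (D j)) (Ob J)) (compatible_families J D Dm)
     in \<lparr>dtop = T, dpaths = {p \<in> paths T. \<forall>j \<in> Ob J. (\<lambda>t\<in>unit_I. p t j) \<in> dpaths (D j)}\<rparr>)"

definition DTop_lim_proj ::
    "('o, 'm) cat \<Rightarrow> ('o \<Rightarrow> 'a dspace) \<Rightarrow> ('m \<Rightarrow> 'a \<Rightarrow> 'a) \<Rightarrow> 'o \<Rightarrow> ('o \<Rightarrow> 'a) \<Rightarrow> 'a"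
  where "DTop_lim_proj J D Dm j = (\<lambda>x \<in> compatible_families J D Dm. x j)"

end

theory Submission imports Defs begin

text \<open>Directed functions pull back along morphisms, so morphisms preserve weakly directed paths.
  Hence the components of a weakly directed path in a limit of saturated d-spaces are weakly directed
  and therefore directed, which is the definition of a directed path of the limit.\<close>

section \<open>Paths on the unit interval, their composites, concatenations and
  reparametrizations\<close>

lemma paths_in_topspace: "p \<in> paths X \<Longrightarrow> t \<in> unit_I \<Longrightarrow> p t \<in> topspace X"
  by (force simp: paths_def pathin_def continuous_map_def)

text \<open>Continuity sees only the values on \<open>unit_I\<close>, so it may be checked on an
  untruncated formula \<open>p\<close>, to which the usual continuity rules apply.\<close>

lemma pathsI:
  assumes "pathin X p" "\<And>t. t \<in> unit_I \<Longrightarrow> p t = q t" "q \<in> extensional unit_I"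
  shows "q \<in> paths X"
  using assms continuous_map_eq[of "top_of_set unit_I" X p q] by (auto simp: paths_def pathin_def)

lemma compose_paths:
  assumes "p \<in> paths X" "continuous_map X Y f"
  shows "compose unit_I f p \<in> paths Y"
  by (rule pathsI[of _ "f \<circ> p"])
     (use assms in \<open>auto simp: paths_def compose_def intro: pathin_compose\<close>)

lemma reparametrize_paths:
  assumes "p \<in> paths X" "\<phi> \<in> paths (top_of_set unit_I)"
  shows "compose unit_I p \<phi> \<in> paths X"
  using assms by (intro compose_paths) (auto simp: paths_def pathin_def)

lemma concat_path_paths:
  assumes "p \<in> paths X" "q \<in> paths X" "p 1 = q 0"
  shows "concat_path p q \<in> paths X"
proof (rule pathsI)
  let ?I = "top_of_set unit_I"
  have p: "continuous_map ?I X p" and q: "continuous_map ?I X q"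
    using assms by (auto simp: paths_def pathin_def)
  have "continuous_map ?I X (\<lambda>t. if t \<le> 1/2 then (p \<circ> (\<lambda>t. 2 * t)) t else (q \<circ> (\<lambda>t. 2 * t - 1)) t)"
  proof (intro continuous_map_cases_le continuous_map_compose[OF _ p] continuous_map_compose[OF _ q])
    show "continuous_map (subtopology ?I {x \<in> topspace ?I. x \<le> 1/2}) ?I ((*) 2)"
      by (auto simp: continuous_map_in_subtopology subtopology_subtopology intro!: continuous_intros)
    show "continuous_map (subtopology ?I {x \<in> topspace ?I. 1/2 \<le> x}) ?I (\<lambda>t. 2 * t - 1)"
      by (auto simp: continuous_map_in_subtopology subtopology_subtopology intro!: continuous_intros)
    \<comment> \<open>At the seam the two pieces take the values \<open>p 1\<close> and
      \<open>q 0\<close>.\<close>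
    show "(p \<circ> (\<lambda>t. 2 * t)) t = (q \<circ> (\<lambda>t. 2 * t - 1)) t" if "t = 1/2" for t
      unfolding that using assms(3) by simp
  qed auto
  then show "pathin X (\<lambda>t. if t \<le> 1/2 then (p \<circ> (\<lambda>t. 2 * t)) t else (q \<circ> (\<lambda>t. 2 * t - 1)) t)"
    by (simp add: pathin_def)
qed (auto simp: concat_path_def)

lemma compose_concat_path:
  "compose unit_I f (concat_path p q) = concat_path (compose unit_I f p) (compose unit_I f q)"
  by (auto simp: concat_path_def compose_def fun_eq_iff)

lemma nondecreasing_paths_in_unit: "\<phi> \<in> nondecreasing_paths \<Longrightarrow> t \<in> unit_I \<Longrightarrow> \<phi> t \<in> unit_I"
  using paths_in_topspace by (fastforce simp: nondecreasing_paths_def)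

section \<open>d-spaces and their morphisms\<close>

lemma is_dspaceD:
  assumes "is_dspace X"
  shows "dpaths X \<subseteq> paths (dtop X)"
    and "x \<in> topspace (dtop X) \<Longrightarrow> (\<lambda>t\<in>unit_I. x) \<in> dpaths X"
    and "p \<in> dpaths X \<Longrightarrow> q \<in> dpaths X \<Longrightarrow> p 1 = q 0 \<Longrightarrow> concat_path p q \<in> dpaths X"
    and "p \<in> dpaths X \<Longrightarrow> \<phi> \<in> nondecreasing_paths \<Longrightarrow> compose unit_I p \<phi> \<in> dpaths X"
  using assms by (auto simp: is_dspace_def)

lemma dmaps_in_topspace: "f \<in> dmaps X Y \<Longrightarrow> x \<in> topspace (dtop X) \<Longrightarrow> f x \<in> topspace (dtop Y)"
  by (force simp: dmaps_def continuous_map_def)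

lemma dmapsI:
  assumes "f \<in> extensional (topspace (dtop X))" "continuous_map (dtop X) (dtop Y) f"
    "\<And>p. p \<in> dpaths X \<Longrightarrow> compose unit_I f p \<in> dpaths Y"
  shows "f \<in> dmaps X Y"
  using assms by (auto simp: dmaps_def)

text \<open>On a directed path, which stays in the space, the truncated composite acts like
  \<open>g\<close> after \<open>f\<close>. Of the axioms for \<open>X\<close> only the first is
  assumed, so the lemma applies to \<open>sub_dspace X U\<close> without a proof that this is a
  d-space.\<close>

lemma dmaps_compose:
  assumes "dpaths X \<subseteq> paths (dtop X)" "f \<in> dmaps X Y" "g \<in> dmaps Y Z"
  shows "compose (topspace (dtop X)) g f \<in> dmaps X Z"
proof (rule dmapsI)
  have "continuous_map (dtop X) (dtop Z) (g \<circ> f)"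
    using assms by (auto simp: dmaps_def intro: continuous_map_compose)
  then show "continuous_map (dtop X) (dtop Z) (compose (topspace (dtop X)) g f)"
    by (rule continuous_map_eq) (auto simp: compose_def)
  fix p assume p: "p \<in> dpaths X"
  then have "compose unit_I (compose (topspace (dtop X)) g f) p = compose unit_I g (compose unit_I f p)"
    using assms(1) paths_in_topspace[of p "dtop X"] by (auto simp: compose_def fun_eq_iff)
  then show "compose unit_I (compose (topspace (dtop X)) g f) p \<in> dpaths Z"
    using assms p by (auto simp: dmaps_def)
qed (simp add: compose_extensional)

lemma dmaps_eqI:
  assumes "f \<in> dmaps X Y" "g \<in> dmaps X Z" "\<And>x. x \<in> topspace (dtop X) \<Longrightarrow> f x = g x"
  shows "f = g"
  using assms by (intro extensionalityI[of _ "topspace (dtop X)"]) (auto simp: dmaps_def)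

section \<open>Initial d-space structures\<close>

text \<open>For continuous \<open>f i\<close> this is the largest set of directed paths on the given
  topology \<open>T\<close> that makes every \<open>f i\<close> a morphism. It serves twice: for the
  standard limit, and for transporting a d-space along a bijection.\<close>

definition initial_dspace ::
    "'b topology \<Rightarrow> 'i set \<Rightarrow> ('i \<Rightarrow> 'b \<Rightarrow> 'a) \<Rightarrow> ('i \<Rightarrow> 'a dspace) \<Rightarrow> 'b dspace"
  where "initial_dspace T A f Y =
    \<lparr>dtop = T, dpaths = {p \<in> paths T. \<forall>i \<in> A. compose unit_I (f i) p \<in> dpaths (Y i)}\<rparr>"

text \<open>Composition with \<open>f i\<close> commutes with forming constant paths, concatenations
  and reparametrizations, so each closure property is inherited from the \<open>Y i\<close>.\<close>

lemma is_dspace_initial_dspace: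
  assumes "\<And>i. i \<in> A \<Longrightarrow> is_dspace (Y i)" "\<And>i. i \<in> A \<Longrightarrow> continuous_map T (dtop (Y i)) (f i)"
  shows "is_dspace (initial_dspace T A f Y)"
  unfolding is_dspace_def initial_dspace_def
proof (simp only: dspace.simps, intro conjI ballI impI)
  fix x assume x: "x \<in> topspace T"
  then show "(\<lambda>t\<in>unit_I. x) \<in> {p \<in> paths T. \<forall>i\<in>A. compose unit_I (f i) p \<in> dpaths (Y i)}"
  proof (intro CollectI conjI ballI)
    show "(\<lambda>t\<in>unit_I. x) \<in> paths T" using x by (intro pathsI[of _ "\<lambda>_. x"]) auto
    fix i assume i: "i \<in> A"
    have "compose unit_I (f i) (\<lambda>t\<in>unit_I. x) = (\<lambda>t\<in>unit_I. f i x)"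
      by (auto simp: compose_def)
    moreover have "f i x \<in> topspace (dtop (Y i))"
      using assms(2)[OF i] x by (force simp: continuous_map_def)
    ultimately show "compose unit_I (f i) (\<lambda>t\<in>unit_I. x) \<in> dpaths (Y i)"
      using is_dspaceD(2)[OF assms(1)[OF i]] by simp
  qed
next
  fix p q
  assume "p \<in> {p \<in> paths T. \<forall>i\<in>A. compose unit_I (f i) p \<in> dpaths (Y i)}"
    "q \<in> {p \<in> paths T. \<forall>i\<in>A. compose unit_I (f i) p \<in> dpaths (Y i)}" "p 1 = q 0"
  then show "concat_path p q \<in> {p \<in> paths T. \<forall>i\<in>A. compose unit_I (f i) p \<in> dpaths (Y i)}"
    by (auto simp: concat_path_paths compose_concat_path compose_eq intro!: is_dspaceD(3)[OF assms(1)])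
next
  fix p \<phi>
  assume p: "p \<in> {p \<in> paths T. \<forall>i\<in>A. compose unit_I (f i) p \<in> dpaths (Y i)}"
    and \<phi>: "\<phi> \<in> nondecreasing_paths"
  have "compose unit_I (f i) (compose unit_I p \<phi>) = compose unit_I (compose unit_I (f i) p) \<phi>" for i
    using nondecreasing_paths_in_unit[OF \<phi>] by (auto simp: compose_def fun_eq_iff)
  then show "compose unit_I p \<phi> \<in> {p \<in> paths T. \<forall>i\<in>A. compose unit_I (f i) p \<in> dpaths (Y i)}"
    using p \<phi> is_dspaceD(4)[OF assms(1)]
    by (auto simp: reparametrize_paths nondecreasing_paths_def)
qed auto

section \<open>Weakly directed paths\<close>

lemma locally_nondecreasing_on_cong:
  assumes "locally_nondecreasing_on A f" "\<And>t. t \<in> A \<Longrightarrow> f t = g t"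
  shows "locally_nondecreasing_on A g"
  unfolding locally_nondecreasing_on_def
proof
  fix t assume "t \<in> A"
  then obtain N where N: "openin (top_of_set A) N" "t \<in> N" "mono_on N f"
    using assms(1) by (auto simp: locally_nondecreasing_on_def)
  have "N \<subseteq> A" using N(1) openin_imp_subset by blast
  then have "mono_on N g"
    using N(3) assms(2) unfolding mono_on_def by (metis subsetD)
  then show "\<exists>N. openin (top_of_set A) N \<and> t \<in> N \<and> mono_on N g" using N by blast
qed

text \<open>Clamping to a small interval around \<open>t\<close> turns a directed path into one that stays in \<open>U\<close>.\<close>

lemma dpaths_subset_weakly_directed_paths:
  assumes X: "is_dspace X"
  shows "dpaths X \<subseteq> weakly_directed_paths X"
  unfolding weakly_directed_paths_def
proof (intro subsetI CollectI conjI allI impI)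
  fix c assume c: "c \<in> dpaths X"
  then show cp: "c \<in> paths (dtop X)" using is_dspaceD(1)[OF X] by blast
  fix U f assume U: "openin (dtop X) U" and f: "f \<in> directed_functions X U"
  define A where "A = {t \<in> unit_I. c t \<in> U}"
  have "openin (top_of_set unit_I) A"
    using cp openin_continuous_map_preimage[OF _ U, of "top_of_set unit_I" c]
    by (auto simp: A_def paths_def pathin_def)
  then obtain S where S: "open S" "A = unit_I \<inter> S" by (auto simp: openin_open)
  show "locally_nondecreasing_on {t \<in> unit_I. c t \<in> U} (f \<circ> c)"
    unfolding A_def[symmetric] locally_nondecreasing_on_def
  proof
    fix t assume t: "t \<in> A"
    \<comment> \<open>The ball is closed because the clamping map can attain the end points
      \<open>t - e\<close> and \<open>t + e\<close>.\<close>
    then obtain e where e: "e > 0" "cball t e \<subseteq> S"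
      using S open_contains_cball[of S] by auto
    define \<phi> where "\<phi> = (\<lambda>s\<in>unit_I. max 0 (max (t - e) (min (min 1 (t + e)) s)))"
    have t01: "0 \<le> t" "t \<le> 1" using t by (auto simp: A_def)
    have \<phi>A: "\<phi> s \<in> A" if "s \<in> unit_I" for s
    proof -
      have "\<phi> s \<in> cball t e" "\<phi> s \<in> unit_I"
        using that t01 e(1) by (auto simp: \<phi>_def dist_real_def)
      then show ?thesis using e(2) S(2) by auto
    qed
    have \<phi>_id: "\<phi> s = s" if "s \<in> A \<inter> ball t e" for s
    proof -
      have "0 \<le> s" "s \<le> 1" "t - e \<le> s" "s \<le> t + e"
        using that by (auto simp: A_def dist_real_def)
      then show ?thesis by (simp add: \<phi>_def)
    qed
    have "\<phi> \<in> paths (top_of_set unit_I)"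
    proof (rule pathsI)
      show "pathin (top_of_set unit_I) (\<lambda>s. max 0 (max (t - e) (min (min 1 (t + e)) s)))"
      proof -
        have "continuous_on unit_I (\<lambda>s. max 0 (max (t - e) (min (min 1 (t + e)) s)))"
          by (intro continuous_intros)
        moreover have "max 0 (max (t - e) (min (min 1 (t + e)) s)) \<in> unit_I" if "s \<in> unit_I" for s
          using that t01 e(1) by simp
        ultimately show ?thesis
          by (simp add: pathin_def continuous_map_in_subtopology image_subset_iff)
      qed
    qed (auto simp: \<phi>_def)
    then have \<phi>: "\<phi> \<in> nondecreasing_paths"
      unfolding nondecreasing_paths_def
      by (auto simp: \<phi>_def intro!: mono_onI max.mono min.mono)
    \<comment> \<open>The clamped path stays in \<open>U\<close>, so \<open>f\<close> makes it
      nondecreasing; on \<open>A \<inter> ball t e\<close> it coincides with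
      \<open>c\<close>.\<close>
    have "compose unit_I c \<phi> \<in> dpaths (sub_dspace X U)"
      using is_dspaceD(4)[OF X c \<phi>] \<phi>A by (auto simp: sub_dspace_def compose_def A_def)
    then have "compose unit_I f (compose unit_I c \<phi>) \<in> nondecreasing_paths"
      using f by (auto simp: directed_functions_def dmaps_def directed_interval_def)
    then have mono: "mono_on unit_I (compose unit_I f (compose unit_I c \<phi>))"
      by (simp add: nondecreasing_paths_def)
    have "openin (top_of_set A) (A \<inter> ball t e)" by (simp add: openin_open_Int)
    moreover have "mono_on (A \<inter> ball t e) (f \<circ> c)"
    proof (rule mono_onI)
      fix r s assume rs: "r \<in> A \<inter> ball t e" "s \<in> A \<inter> ball t e" "r \<le> s"
      have *: "r \<in> unit_I" "s \<in> unit_I" "\<phi> r = r" "\<phi> s = s"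
        using \<phi>_id rs by (auto simp: A_def)
      then show "(f \<circ> c) r \<le> (f \<circ> c) s"
        using mono_onD[OF mono *(1,2) rs(3)] by (simp add: compose_def)
    qed
    ultimately show "\<exists>N. openin (top_of_set A) N \<and> t \<in> N \<and> mono_on N (f \<circ> c)"
      using t e(1) by (intro exI[of _ "A \<inter> ball t e"]) auto
  qed
qed

text \<open>A directed function \<open>g\<close> on \<open>V\<close> pulls back to the directed
  function \<open>g\<close> after \<open>f\<close> on the preimage \<open>U\<close> of
  \<open>V\<close>. Testing the image path against \<open>g\<close> is then the same as testing
  \<open>c\<close> against this pullback.\<close>

lemma dmaps_weakly_directed_paths:
  assumes X: "is_dspace X" and f: "f \<in> dmaps X Y" and c: "c \<in> weakly_directed_paths X"
  shows "compose unit_I f c \<in> weakly_directed_paths Y"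
  unfolding weakly_directed_paths_def
proof (intro CollectI conjI allI impI)
  have cp: "c \<in> paths (dtop X)" using c by (simp add: weakly_directed_paths_def)
  have fc: "continuous_map (dtop X) (dtop Y) f" using f by (simp add: dmaps_def)
  show "compose unit_I f c \<in> paths (dtop Y)" by (rule compose_paths[OF cp fc])
  fix V g assume V: "openin (dtop Y) V" and g: "g \<in> directed_functions Y V"
  define U where "U = {x \<in> topspace (dtop X). f x \<in> V}"
  have U: "openin (dtop X) U" unfolding U_def by (rule openin_continuous_map_preimage[OF fc V])
  have tU: "topspace (dtop (sub_dspace X U)) = U" by (auto simp: sub_dspace_def U_def)
  \<comment> \<open>Morphisms are truncated to the space they start from, so \<open>f\<close> has to
    be cut down to \<open>U\<close>.\<close>
  have fU: "restrict f U \<in> dmaps (sub_dspace X U) (sub_dspace Y V)"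
  proof (rule dmapsI)
    have "continuous_map (subtopology (dtop X) U) (subtopology (dtop Y) V) f"
      using fc by (auto simp: continuous_map_in_subtopology U_def continuous_map_from_subtopology)
    then show "continuous_map (dtop (sub_dspace X U)) (dtop (sub_dspace Y V)) (restrict f U)"
      unfolding sub_dspace_def dspace.simps by (rule continuous_map_eq) auto
    fix p assume p: "p \<in> dpaths (sub_dspace X U)"
    then have "compose unit_I (restrict f U) p = compose unit_I f p"
      by (force simp: sub_dspace_def compose_def fun_eq_iff)
    then show "compose unit_I (restrict f U) p \<in> dpaths (sub_dspace Y V)"
      using p f by (auto simp: sub_dspace_def dmaps_def U_def compose_def)
  qed (simp add: tU)
  have "dpaths (sub_dspace X U) \<subseteq> paths (dtop (sub_dspace X U))"
    using is_dspaceD(1)[OF X] by (auto simp: sub_dspace_def paths_def pathin_subtopology)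
  then have "compose U g (restrict f U) \<in> directed_functions X U"
    using dmaps_compose[OF _ fU, of g directed_interval] g by (simp add: directed_functions_def tU)
  then have "locally_nondecreasing_on {t \<in> unit_I. c t \<in> U} (compose U g (restrict f U) \<circ> c)"
    using c U by (auto simp: weakly_directed_paths_def)
  \<comment> \<open>Both tests concern the same set of parameters, since \<open>c\<close> never
    leaves the space.\<close>
  moreover have "{t \<in> unit_I. c t \<in> U} = {t \<in> unit_I. compose unit_I f c t \<in> V}"
    using paths_in_topspace[OF cp] by (auto simp: U_def compose_def)
  ultimately have "locally_nondecreasing_on {t \<in> unit_I. compose unit_I f c t \<in> V}
      (compose U g (restrict f U) \<circ> c)" by simp
  then show "locally_nondecreasing_on {t \<in> unit_I. compose unit_I f c t \<in> V} (g \<circ> compose unit_I f c)"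
    by (rule locally_nondecreasing_on_cong)
       (use paths_in_topspace[OF cp] in \<open>auto simp: compose_def U_def\<close>)
qed

section \<open>Saturated d-spaces and the ways to obtain them\<close>

lemma saturatedI:
  assumes "is_dspace X" "weakly_directed_paths X \<subseteq> dpaths X"
  shows "saturated X"
  using assms dpaths_subset_weakly_directed_paths unfolding saturated_def by blast

text \<open>The core of the argument, for any family of continuous maps: each \<open>f i\<close>
  sends a weakly directed path to a weakly directed path of \<open>Y i\<close>, which is directed by
  saturation, and this for all \<open>i\<close> is directedness in the initial structure.\<close>

lemma saturated_initial_dspace:
  assumes "\<And>i. i \<in> A \<Longrightarrow> saturated (Y i)" "\<And>i. i \<in> A \<Longrightarrow> continuous_map T (dtop (Y i)) (f i)"
  shows "saturated (initial_dspace T A f Y)"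
proof (rule saturatedI)
  let ?X = "initial_dspace T A f Y"
  show X: "is_dspace ?X"
    using assms by (intro is_dspace_initial_dspace) (auto simp: saturated_def)
  show "weakly_directed_paths ?X \<subseteq> dpaths ?X"
  proof
    fix c assume c: "c \<in> weakly_directed_paths ?X"
    then have cp: "c \<in> paths T" by (simp add: weakly_directed_paths_def initial_dspace_def)
    moreover have "compose unit_I (f i) c \<in> dpaths (Y i)" if i: "i \<in> A" for i
    proof -
      \<comment> \<open>The maps \<open>f i\<close> need not be extensional; truncating them makes
        them morphisms and does not change their effect on paths.\<close>
      have eq: "compose unit_I (restrict (f i) (topspace T)) p = compose unit_I (f i) p"
        if "p \<in> paths T" for p
        using paths_in_topspace[OF that] by (auto simp: compose_def fun_eq_iff)
      have "restrict (f i) (topspace T) \<in> dmaps ?X (Y i)"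
        using i continuous_map_eq[OF assms(2)[OF i]]
        by (intro dmapsI) (auto simp: initial_dspace_def eq)
      from dmaps_weakly_directed_paths[OF X this c] show ?thesis
        using assms(1)[OF i] by (simp add: saturated_def eq[OF cp])
    qed
    ultimately show "c \<in> dpaths ?X" by (simp add: initial_dspace_def)
  qed
qed

text \<open>A weakly directed path is pushed to \<open>X\<close> by \<open>h\<close>, is directed
  there by saturation, and is brought back by \<open>g\<close>. A one-sided inverse suffices, so the
  lemma covers retracts of saturated d-spaces.\<close>

lemma saturated_isomorphic:
  assumes L: "is_dspace L" and X: "saturated X" and h: "h \<in> dmaps L X" and g: "g \<in> dmaps X L"
    and gh: "\<And>l. l \<in> topspace (dtop L) \<Longrightarrow> g (h l) = l"
  shows "saturated L"
proof (rule saturatedI[OF L], rule subsetI)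
  fix c assume c: "c \<in> weakly_directed_paths L"
  then have cp: "c \<in> paths (dtop L)" by (simp add: weakly_directed_paths_def)
  have "compose unit_I h c \<in> dpaths X"
    using dmaps_weakly_directed_paths[OF L h c] X by (simp add: saturated_def)
  then have "compose unit_I g (compose unit_I h c) \<in> dpaths L" using g by (simp add: dmaps_def)
  moreover have "compose unit_I g (compose unit_I h c) = c"
    using paths_in_topspace[OF cp] gh cp
    by (intro extensionalityI[of _ unit_I]) (auto simp: compose_def paths_def)
  ultimately show "c \<in> dpaths L" by simp
qed

section \<open>The standard limit in \<open>DTop\<close> and its universal property\<close>

text \<open>Makes the results on initial structures, taken for the coordinate projections, available
  for the limit.\<close>

lemma DTop_lim_eq_initial_dspace:
  "DTop_lim J D Dm = initial_dspace
     (subtopology (product_topology (\<lambda>j. dtop (D j)) (Ob J)) (compatible_families J D Dm))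
     (Ob J) (\<lambda>j x. x j) D"
  by (simp add: DTop_lim_def initial_dspace_def Let_def compose_def)

lemma topspace_DTop_lim: "topspace (dtop (DTop_lim J D Dm)) = compatible_families J D Dm"
  by (auto simp: DTop_lim_def Let_def compatible_families_def)

lemma continuous_map_DTop_lim_component:
  "j \<in> Ob J \<Longrightarrow> continuous_map
     (subtopology (product_topology (\<lambda>j. dtop (D j)) (Ob J)) (compatible_families J D Dm))
     (dtop (D j)) (\<lambda>x. x j)"
  by (intro continuous_map_from_subtopology continuous_map_product_projection)

lemma is_dspace_DTop_lim: "DTop_diagram J D Dm \<Longrightarrow> is_dspace (DTop_lim J D Dm)"
  unfolding DTop_lim_eq_initial_dspace
  by (rule is_dspace_initial_dspace) (simp_all add: DTop_diagram_def continuous_map_DTop_lim_component)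

lemma saturated_DTop_lim: "SDTop_diagram J D Dm \<Longrightarrow> saturated (DTop_lim J D Dm)"
  unfolding DTop_lim_eq_initial_dspace
  by (rule saturated_initial_dspace) (simp_all add: SDTop_diagram_def continuous_map_DTop_lim_component)

lemma cone_DTop_lim:
  assumes "is_category J"
  shows "cone J D Dm (DTop_lim J D Dm) (DTop_lim_proj J D Dm)"
  unfolding cone_def
proof (intro conjI ballI)
  let ?C = "compatible_families J D Dm"
  fix j assume j: "j \<in> Ob J"
  show "DTop_lim_proj J D Dm j \<in> dmaps (DTop_lim J D Dm) (D j)"
  proof (rule dmapsI)
    show "continuous_map (dtop (DTop_lim J D Dm)) (dtop (D j)) (DTop_lim_proj J D Dm j)"
      unfolding DTop_lim_eq_initial_dspace initial_dspace_def DTop_lim_proj_def dspace.simps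
      by (rule continuous_map_eq[OF continuous_map_DTop_lim_component[OF j]])
         (auto simp: compatible_families_def)
    fix p assume p: "p \<in> dpaths (DTop_lim J D Dm)"
    then have "p \<in> paths (dtop (DTop_lim J D Dm))" by (simp add: DTop_lim_def Let_def)
    then have "p t \<in> ?C" if "t \<in> unit_I" for t
      using paths_in_topspace that topspace_DTop_lim by metis
    then have "compose unit_I (DTop_lim_proj J D Dm j) p = (\<lambda>t\<in>unit_I. p t j)"
      by (auto simp: compose_def DTop_lim_proj_def fun_eq_iff)
    then show "compose unit_I (DTop_lim_proj J D Dm j) p \<in> dpaths (D j)"
      using p j by (simp add: DTop_lim_def Let_def)
  qed (simp add: topspace_DTop_lim DTop_lim_proj_def)
next
  fix m assume m: "m \<in> Mor J"
  then show "compose (topspace (dtop (DTop_lim J D Dm))) (Dm m) (DTop_lim_proj J D Dm (Src J m)) =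
      DTop_lim_proj J D Dm (Tgt J m)"
    unfolding topspace_DTop_lim
    by (auto simp: compose_def DTop_lim_proj_def fun_eq_iff compatible_families_def)
qed

text \<open>The equations for a mediating map prescribe each of its coordinates, which gives
  uniqueness; the map with these coordinates is a morphism because topology and directed paths of
  the limit are tested coordinatewise.\<close>

lemma universal_DTop_lim:
  fixes K :: "'c dspace \<Rightarrow> bool"
  assumes K: "\<And>Z. K Z \<Longrightarrow> is_dspace Z" and J: "is_category J"
  shows "universal_for K J D Dm (DTop_lim J D Dm) (DTop_lim_proj J D Dm)"
  unfolding universal_for_def
proof (intro allI impI)
  fix Z :: "'c dspace" and \<rho> assume Z: "K Z" and \<rho>: "cone J D Dm Z \<rho>"
  let ?C = "compatible_families J D Dm" and ?Z = "topspace (dtop Z)" and ?X = "DTop_lim J D Dm"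
  have \<rho>d: "\<rho> j \<in> dmaps Z (D j)" if "j \<in> Ob J" for j using \<rho> that by (simp add: cone_def)
  \<comment> \<open>The outer truncation makes \<open>h\<close> extensional as a morphism, the inner
    one puts \<open>h z\<close> into the extensional product.\<close>
  define h where "h = (\<lambda>z\<in>?Z. \<lambda>j\<in>Ob J. \<rho> j z)"
  have hC: "h z \<in> ?C" if z: "z \<in> ?Z" for z
  proof -
    have "Dm m (\<rho> (Src J m) z) = \<rho> (Tgt J m) z" if "m \<in> Mor J" for m
      using \<rho> z that unfolding cone_def by (metis compose_eq)
    \<comment> \<open>As \<open>J\<close> is a category, sources and targets lie in
      \<open>Ob J\<close>, where \<open>h z\<close> takes the values \<rho> and not
      \<open>undefined\<close>.\<close>
    then show ?thesis
      using z J dmaps_in_topspace[OF \<rho>d] by (auto simp: h_def compatible_families_def is_category_def)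
  qed
  have hd: "h \<in> dmaps Z ?X"
  proof (rule dmapsI)
    have "continuous_map (dtop Z) (product_topology (\<lambda>j. dtop (D j)) (Ob J)) h"
      unfolding continuous_map_componentwise
    proof (intro conjI ballI)
      show "h ` ?Z \<subseteq> extensional (Ob J)" by (auto simp: h_def)
      fix j assume j: "j \<in> Ob J"
      show "continuous_map (dtop Z) (dtop (D j)) (\<lambda>z. h z j)"
        by (rule continuous_map_eq[of _ _ "\<rho> j"]) (use \<rho>d[OF j] j in \<open>auto simp: h_def dmaps_def\<close>)
    qed
    then show hc: "continuous_map (dtop Z) (dtop ?X) h"
      using hC by (auto simp: DTop_lim_def Let_def continuous_map_in_subtopology)
    fix p assume p: "p \<in> dpaths Z"
    have pp: "p \<in> paths (dtop Z)" using p is_dspaceD(1)[OF K[OF Z]] by blast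
    have "(\<lambda>t\<in>unit_I. compose unit_I h p t j) = compose unit_I (\<rho> j) p" if "j \<in> Ob J" for j
      using that paths_in_topspace[OF pp] by (auto simp: compose_def h_def fun_eq_iff)
    moreover have "compose unit_I (\<rho> j) p \<in> dpaths (D j)" if "j \<in> Ob J" for j
      using \<rho>d[OF that] p by (simp add: dmaps_def)
    ultimately show "compose unit_I h p \<in> dpaths ?X"
      using compose_paths[OF pp hc] by (simp add: DTop_lim_def Let_def)
  qed (simp add: h_def)
  show "\<exists>!h. h \<in> dmaps Z ?X \<and> (\<forall>j\<in>Ob J. compose ?Z (DTop_lim_proj J D Dm j) h = \<rho> j)"
  proof (intro ex1I conjI ballI)
    show "h \<in> dmaps Z ?X" by (rule hd)
    fix j assume j: "j \<in> Ob J"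
    show "compose ?Z (DTop_lim_proj J D Dm j) h = \<rho> j"
      by (rule extensionalityI[of _ ?Z])
         (use j \<rho>d[OF j] hC in \<open>auto simp: compose_def DTop_lim_proj_def dmaps_def h_def\<close>)
  next
    fix k assume k: "k \<in> dmaps Z ?X \<and> (\<forall>j\<in>Ob J. compose ?Z (DTop_lim_proj J D Dm j) k = \<rho> j)"
    show "k = h"
    proof (rule dmaps_eqI[OF conjunct1[OF k] hd])
      fix z assume z: "z \<in> ?Z"
      have kC: "k z \<in> ?C" using dmaps_in_topspace[OF conjunct1[OF k] z] by (simp add: topspace_DTop_lim)
      have "k z j = \<rho> j z" if "j \<in> Ob J" for j
      proof -
        have "DTop_lim_proj J D Dm j (k z) = \<rho> j z"
          using conjunct2[OF k] that z by (metis compose_eq)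
        then show ?thesis using kC by (simp add: DTop_lim_proj_def)
      qed
      then show "k z = h z"
        using kC z by (intro extensionalityI[of _ "Ob J"]) (auto simp: h_def compatible_families_def PiE_def)
    qed
  qed
qed

lemma DTop_limit_DTop_lim:
  assumes "is_category J" "DTop_diagram J D Dm"
  shows "DTop_limit TYPE('c) J D Dm (DTop_lim J D Dm) (DTop_lim_proj J D Dm)"
  unfolding DTop_limit_def using assms is_dspace_DTop_lim cone_DTop_lim universal_DTop_lim by blast

section \<open>From limits in \<open>DTop\<close> to limits in \<open>SDTop\<close>\<close>

lemma universal_for_mono:
  assumes "universal_for K J D Dm L \<pi>" "\<And>Z. K' Z \<Longrightarrow> K Z"
  shows "universal_for K' J D Dm L \<pi>"
  using assms unfolding universal_for_def by blast

text \<open>By fullness, cones and mediating maps are the same in both categories, so only the class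
  of test objects shrinks.\<close>

lemma SDTop_limit_if_DTop_limit:
  assumes "DTop_limit TYPE('c) J D Dm L \<pi>" "saturated L"
  shows "SDTop_limit TYPE('c) J D Dm L \<pi>"
  using assms universal_for_mono[of is_dspace J D Dm L \<pi> saturated]
  unfolding DTop_limit_def SDTop_limit_def saturated_def by blast

section \<open>Cones and consequences of universality\<close>

lemma cone_compose:
  assumes Z: "is_dspace Z" and X: "cone J D Dm X \<pi>" and h: "h \<in> dmaps Z X"
  shows "cone J D Dm Z (\<lambda>j. compose (topspace (dtop Z)) (\<pi> j) h)"
  unfolding cone_def
proof (intro conjI ballI)
  fix j assume "j \<in> Ob J"
  then show "compose (topspace (dtop Z)) (\<pi> j) h \<in> dmaps Z (D j)"
    using X by (intro dmaps_compose[OF is_dspaceD(1)[OF Z] h]) (simp add: cone_def)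
next
  fix m assume "m \<in> Mor J"
  then have "compose (topspace (dtop X)) (Dm m) (\<pi> (Src J m)) = \<pi> (Tgt J m)"
    using X by (simp add: cone_def)
  then have "Dm m (\<pi> (Src J m) x) = \<pi> (Tgt J m) x" if "x \<in> topspace (dtop X)" for x
    using that by (metis compose_eq)
  then show "compose (topspace (dtop Z)) (Dm m) (compose (topspace (dtop Z)) (\<pi> (Src J m)) h) =
      compose (topspace (dtop Z)) (\<pi> (Tgt J m)) h"
    using dmaps_in_topspace[OF h] by (auto simp: compose_def fun_eq_iff)
qed

text \<open>The existence half, with pointwise equations in place of equations between truncated
  composites.\<close>

lemma universal_forE:
  assumes "universal_for K J D Dm X \<rho>" "K Z" "cone J D Dm Z \<sigma>"
  obtains k where "k \<in> dmaps Z X"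
    "\<And>j z. j \<in> Ob J \<Longrightarrow> z \<in> topspace (dtop Z) \<Longrightarrow> \<rho> j (k z) = \<sigma> j z"
proof -
  obtain k where k: "k \<in> dmaps Z X" "\<forall>j\<in>Ob J. compose (topspace (dtop Z)) (\<rho> j) k = \<sigma> j"
    using assms unfolding universal_for_def by blast
  show thesis
  proof (rule that[OF k(1)])
    fix j z assume "j \<in> Ob J" "z \<in> topspace (dtop Z)"
    then show "\<rho> j (k z) = \<sigma> j z" using bspec[OF k(2)] by (metis compose_eq)
  qed
qed

text \<open>The legs of a limit are jointly monic: both maps mediate the cone obtained by composing
  the legs with \<open>k\<close>.\<close>

lemma universal_for_unique:
  assumes X: "universal_for K J D Dm X \<rho>" "cone J D Dm X \<rho>" and Z: "K Z" "is_dspace Z"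
    and k: "k \<in> dmaps Z X" "k' \<in> dmaps Z X"
    and eq: "\<And>j z. j \<in> Ob J \<Longrightarrow> z \<in> topspace (dtop Z) \<Longrightarrow> \<rho> j (k z) = \<rho> j (k' z)"
  shows "k = k'"
proof -
  let ?\<sigma> = "\<lambda>j. compose (topspace (dtop Z)) (\<rho> j) k"
  have "cone J D Dm Z ?\<sigma>" by (rule cone_compose[OF Z(2) X(2) k(1)])
  then have "\<exists>!u. u \<in> dmaps Z X \<and> (\<forall>j\<in>Ob J. compose (topspace (dtop Z)) (\<rho> j) u = ?\<sigma> j)"
    using X(1) Z(1) unfolding universal_for_def by blast
  moreover have "\<forall>j\<in>Ob J. compose (topspace (dtop Z)) (\<rho> j) k' = ?\<sigma> j"
    using eq by (auto simp: compose_def fun_eq_iff)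
  ultimately show ?thesis using k by blast
qed

section \<open>Comparison of limits whose universal properties are tested on different types\<close>

text \<open>Morphisms out of this space are points of the target. Every HOL type is inhabited, so
  such a test object exists on each type.\<close>

definition point_dspace :: "'a \<Rightarrow> 'a dspace"
  where "point_dspace a = \<lparr>dtop = discrete_topology {a}, dpaths = {\<lambda>t\<in>unit_I. a}\<rparr>"

lemma is_dspace_point_dspace: "is_dspace (point_dspace a)"
proof -
  have "(\<lambda>t\<in>unit_I. a) \<in> paths (discrete_topology {a})"
    by (rule pathsI[of _ "\<lambda>_. a"]) auto
  moreover have "compose unit_I (\<lambda>t\<in>unit_I. a) \<phi> = (\<lambda>t\<in>unit_I. a)" if "\<phi> \<in> nondecreasing_paths" for \<phi>
    using nondecreasing_paths_in_unit[OF that] by (auto simp: compose_def fun_eq_iff)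
  ultimately show ?thesis
    by (auto simp: is_dspace_def point_dspace_def concat_path_def fun_eq_iff)
qed

lemma dmaps_point_dspace:
  assumes "is_dspace X" "x \<in> topspace (dtop X)"
  shows "(\<lambda>z\<in>{a}. x) \<in> dmaps (point_dspace a) X"
proof (rule dmapsI)
  have "compose unit_I (\<lambda>z\<in>{a}. x) (\<lambda>t\<in>unit_I. a) = (\<lambda>t\<in>unit_I. x)"
    by (auto simp: compose_def)
  then show "compose unit_I (\<lambda>z\<in>{a}. x) p \<in> dpaths X" if "p \<in> dpaths (point_dspace a)" for p
    using that is_dspaceD(2)[OF assms] by (simp add: point_dspace_def)
qed (use assms in \<open>auto simp: point_dspace_def\<close>)

text \<open>The universal properties of \<open>L\<close> and \<open>X\<close> are tested on different types, so the usual
  uniqueness argument does not apply directly. But the comparison map \<open>h\<close> is bijective on points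
  (test on one-point spaces), so \<open>X\<close> can be transported to the type of \<open>L\<close>, which yields the inverse.\<close>

lemma DTop_limit_isomorphic:
  fixes L :: "'l dspace" and X :: "'x dspace"
  assumes L: "DTop_limit TYPE('l) J D Dm L \<pi>" and X: "DTop_limit TYPE('x) J D Dm X \<rho>"
    and XL: "universal_for (is_dspace :: 'l dspace \<Rightarrow> bool) J D Dm X \<rho>"
  obtains h g where "h \<in> dmaps L X" "g \<in> dmaps X L"
    "\<And>l. l \<in> topspace (dtop L) \<Longrightarrow> g (h l) = l" "\<And>x. x \<in> topspace (dtop X) \<Longrightarrow> h (g x) = x"
    "\<And>j. j \<in> Ob J \<Longrightarrow> compose (topspace (dtop L)) (\<rho> j) h = \<pi> j"
proof -
  have dL: "is_dspace L" "cone J D Dm L \<pi>" "universal_for (is_dspace :: 'l dspace \<Rightarrow> bool) J D Dm L \<pi>"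
    using L by (auto simp: DTop_limit_def)
  have dX: "is_dspace X" "cone J D Dm X \<rho>" using X by (auto simp: DTop_limit_def)
  let ?L = "topspace (dtop L)" and ?X = "topspace (dtop X)"
  obtain h where h: "h \<in> dmaps L X" and \<rho>h: "\<And>j l. j \<in> Ob J \<Longrightarrow> l \<in> ?L \<Longrightarrow> \<rho> j (h l) = \<pi> j l"
    using universal_forE[OF XL dL(1,2)] by blast
  have L_unique: "k = k'" if "is_dspace (Z :: 'l dspace)" "k \<in> dmaps Z L" "k' \<in> dmaps Z L"
    "\<And>j z. j \<in> Ob J \<Longrightarrow> z \<in> topspace (dtop Z) \<Longrightarrow> \<pi> j (k z) = \<pi> j (k' z)" for Z k k'
    using universal_for_unique[OF dL(3,2) that(1,1-4)] .
  have X_unique: "k = k'" if "is_dspace (Z :: 'l dspace)" "k \<in> dmaps Z X" "k' \<in> dmaps Z X"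
    "\<And>j z. j \<in> Ob J \<Longrightarrow> z \<in> topspace (dtop Z) \<Longrightarrow> \<rho> j (k z) = \<rho> j (k' z)" for Z k k'
    using universal_for_unique[OF XL dX(2) that(1,1-4)] .
  let ?P = "point_dspace (undefined :: 'l)"
  have P: "topspace (dtop ?P) = {undefined}" by (simp add: point_dspace_def)
  have inj: "inj_on h ?L"
  proof (rule inj_onI)
    fix l l' assume l: "l \<in> ?L" "l' \<in> ?L" "h l = h l'"
    \<comment> \<open>Equal images under \<open>h\<close> give equal values of all legs \<pi>, so
      the two points, as morphisms from the one-point space, agree by uniqueness for
      \<open>L\<close>.\<close>
    have "(\<lambda>z\<in>{undefined :: 'l}. l) = (\<lambda>z\<in>{undefined}. l')"
    proof (rule L_unique[OF is_dspace_point_dspace])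
      fix j z assume "j \<in> Ob J" "z \<in> topspace (dtop ?P)"
      then show "\<pi> j (restrict (\<lambda>_. l) {undefined} z) = \<pi> j (restrict (\<lambda>_. l') {undefined} z)"
        using l by (simp add: P flip: \<rho>h)
    qed (use dL l in \<open>auto intro: dmaps_point_dspace\<close>)
    then show "l = l'" by (metis restrict_apply' singletonI)
  qed
  have surj: "\<exists>l\<in>?L. h l = x" if x: "x \<in> ?X" for x
  proof -
    let ?k = "\<lambda>z\<in>{undefined :: 'l}. x"
    have k: "?k \<in> dmaps ?P X" using dX x by (auto intro: dmaps_point_dspace)
    \<comment> \<open>Composing the legs \<rho> with the point \<open>x\<close> gives a cone over
      the one-point space; it factors through \<open>L\<close> and yields the candidate preimage of
      \<open>x\<close>.\<close>
    obtain u where u: "u \<in> dmaps ?P L"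
      and \<pi>u: "\<And>j z. j \<in> Ob J \<Longrightarrow> z \<in> topspace (dtop ?P) \<Longrightarrow>
        \<pi> j (u z) = compose (topspace (dtop ?P)) (\<rho> j) ?k z"
      using universal_forE[OF dL(3) is_dspace_point_dspace
          cone_compose[OF is_dspace_point_dspace dX(2) k]] by blast
    have uL: "u undefined \<in> ?L" using dmaps_in_topspace[OF u] P by auto
    have "compose {undefined} h u = ?k"
    proof (rule X_unique[OF is_dspace_point_dspace _ k])
      show "compose {undefined} h u \<in> dmaps ?P X"
        using dmaps_compose[OF is_dspaceD(1)[OF is_dspace_point_dspace] u h] by (simp add: P)
    qed (use \<pi>u \<rho>h uL in \<open>auto simp: P compose_def\<close>)
    then have "h (u undefined) = x" by (metis compose_eq restrict_apply' singletonI)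
    then show ?thesis using uL by blast
  qed
  \<comment> \<open>\<open>M\<close> is \<open>X\<close> carried along \<open>h\<close> to the
    points of \<open>L\<close>, hence a test object on the type \<open>'l\<close>. The structure of
    \<open>L\<close> could a priori be finer; the morphism \<open>k\<close> from \<open>M\<close> to
    \<open>L\<close> below rules this out.\<close>
  define M where "M = initial_dspace (pullback_topology ?L h (dtop X)) UNIV (\<lambda>_ :: unit. h) (\<lambda>_. X)"
  have hL: "h l \<in> ?X" if "l \<in> ?L" for l using dmaps_in_topspace[OF h that] .
  have tM: "topspace (dtop M) = ?L"
    using hL by (auto simp: M_def initial_dspace_def topspace_pullback_topology)
  have hM_cont: "continuous_map (pullback_topology ?L h (dtop X)) (dtop X) h"
    using continuous_map_pullback[OF continuous_map_id, of ?L h "dtop X"] by simp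
  have M: "is_dspace M"
    unfolding M_def using dX hM_cont by (intro is_dspace_initial_dspace) auto
  have hM: "h \<in> dmaps M X"
    using h hM_cont tM by (intro dmapsI) (auto simp: dmaps_def M_def initial_dspace_def)
  obtain k where k: "k \<in> dmaps M L"
    and \<pi>k: "\<And>j l. j \<in> Ob J \<Longrightarrow> l \<in> ?L \<Longrightarrow> \<pi> j (k l) = compose ?L (\<rho> j) h l"
    using universal_forE[OF dL(3) M cone_compose[OF M dX(2) hM]] unfolding tM by blast
  have kL: "k l \<in> ?L" if "l \<in> ?L" for l using dmaps_in_topspace[OF k] that by (simp add: tM)
  \<comment> \<open>Uniqueness for \<open>X\<close>, together with injectivity of \<open>h\<close>,
    forces \<open>k\<close> to be the identity on points.\<close>
  have "compose ?L h k = h"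
  proof (rule X_unique[OF M _ hM])
    show "compose ?L h k \<in> dmaps M X"
      using dmaps_compose[OF is_dspaceD(1)[OF M] k h] by (simp add: tM)
    fix j z assume "j \<in> Ob J" "z \<in> topspace (dtop M)"
    then show "\<rho> j (compose ?L h k z) = \<rho> j (h z)"
      using \<pi>k \<rho>h kL by (simp add: tM compose_eq)
  qed
  then have k_id: "k l = l" if "l \<in> ?L" for l
    using inj_onD[OF inj _ kL[OF that] that] that by (metis compose_eq)
  define g where "g = (\<lambda>x\<in>?X. inv_into ?L h x)"
  have g: "g x \<in> ?L" "h (g x) = x" if "x \<in> ?X" for x
  proof -
    have "x \<in> h ` ?L" using surj[OF that] by blast
    then show "g x \<in> ?L" "h (g x) = x" using that by (simp_all add: g_def inv_into_into f_inv_into_f)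
  qed
  have gM: "g \<in> dmaps X M"
  proof (rule dmapsI)
    \<comment> \<open>Maps into the initial structure \<open>M\<close> are tested after
      \<open>h\<close>, where \<open>g\<close> becomes the identity.\<close>
    have "continuous_map (dtop X) (dtop X) (h \<circ> g)"
      by (rule continuous_map_eq[OF continuous_map_id]) (simp add: g)
    then show gc: "continuous_map (dtop X) (dtop M) g"
      unfolding M_def initial_dspace_def using g(1) by (auto intro!: continuous_map_pullback')
    fix p assume p: "p \<in> dpaths X"
    then have pp: "p \<in> paths (dtop X)" using is_dspaceD(1)[OF dX(1)] by blast
    have "compose unit_I h (compose unit_I g p) = p"
      using pp g(2) paths_in_topspace[OF pp]
      by (intro extensionalityI[of _ unit_I]) (auto simp: compose_def paths_def)
    then show "compose unit_I g p \<in> dpaths M"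
      using p compose_paths[OF pp gc] by (simp add: M_def initial_dspace_def)
  qed (simp add: g_def)
  \<comment> \<open>Since \<open>k\<close> fixes points, following \<open>g\<close> by
    \<open>k\<close> turns the morphism into \<open>M\<close> into a morphism into \<open>L\<close>
    with the same values.\<close>
  have "compose ?X k g = g"
    using g(1) k_id by (intro extensionalityI[of _ ?X]) (auto simp: compose_def g_def)
  then have gL: "g \<in> dmaps X L"
    using dmaps_compose[OF is_dspaceD(1)[OF dX(1)] gM k] by simp
  have gh: "g (h l) = l" if "l \<in> ?L" for l
    using inj that hL by (simp add: g_def)
  have "compose ?L (\<rho> j) h = \<pi> j" if "j \<in> Ob J" for j
    using \<rho>h dL(2) that
    by (intro extensionalityI[of _ ?L]) (auto simp: compose_eq compose_extensional cone_def dmaps_def)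
  then show thesis using that[OF h gL gh g(2)] by blast
qed

text \<open>Mediating maps into \<open>L\<close> and into \<open>X\<close> correspond under
  \<open>h\<close> and \<open>g\<close>. The type of the test objects is arbitrary here, so a limit
  known to be universal on its own type only acquires universality on every type on which
  \<open>X\<close> has it.\<close>

lemma universal_for_isomorphic:
  fixes K :: "'c dspace \<Rightarrow> bool"
  assumes X: "universal_for K J D Dm X \<rho>" and K: "\<And>Z. K Z \<Longrightarrow> is_dspace Z"
    and h: "h \<in> dmaps L X" and g: "g \<in> dmaps X L"
    and gh: "\<And>l. l \<in> topspace (dtop L) \<Longrightarrow> g (h l) = l"
    and hg: "\<And>x. x \<in> topspace (dtop X) \<Longrightarrow> h (g x) = x"
    and \<rho>h: "\<And>j. j \<in> Ob J \<Longrightarrow> compose (topspace (dtop L)) (\<rho> j) h = \<pi> j"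
  shows "universal_for K J D Dm L \<pi>"
  unfolding universal_for_def
proof (intro allI impI)
  fix Z :: "'c dspace" and \<sigma> assume Z: "K Z" and \<sigma>: "cone J D Dm Z \<sigma>"
  let ?Z = "topspace (dtop Z)"
  have Zp: "dpaths Z \<subseteq> paths (dtop Z)" using K[OF Z] by (rule is_dspaceD(1))
  have \<rho>h': "\<rho> j (h l) = \<pi> j l" if "j \<in> Ob J" "l \<in> topspace (dtop L)" for j l
    using \<rho>h[OF that(1)] that(2) by (metis compose_eq)
  obtain u where u: "u \<in> dmaps Z X" and \<rho>u: "\<forall>j\<in>Ob J. compose ?Z (\<rho> j) u = \<sigma> j"
    and uniq: "\<And>v. v \<in> dmaps Z X \<Longrightarrow> \<forall>j\<in>Ob J. compose ?Z (\<rho> j) v = \<sigma> j \<Longrightarrow> v = u"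
  proof -
    have "\<exists>!u. u \<in> dmaps Z X \<and> (\<forall>j\<in>Ob J. compose ?Z (\<rho> j) u = \<sigma> j)"
      using X Z \<sigma> unfolding universal_for_def by blast
    then show thesis using that by blast
  qed
  have uX: "u z \<in> topspace (dtop X)" if "z \<in> ?Z" for z by (rule dmaps_in_topspace[OF u that])
  have gX: "g x \<in> topspace (dtop L)" if "x \<in> topspace (dtop X)" for x
    by (rule dmaps_in_topspace[OF g that])
  show "\<exists>!k. k \<in> dmaps Z L \<and> (\<forall>j\<in>Ob J. compose ?Z (\<pi> j) k = \<sigma> j)"
  proof (intro ex1I conjI ballI)
    show gu: "compose ?Z g u \<in> dmaps Z L" by (rule dmaps_compose[OF Zp u g])
    fix j assume j: "j \<in> Ob J"
    have "\<pi> j (g x) = \<rho> j x" if "x \<in> topspace (dtop X)" for x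
      using \<rho>h'[OF j gX[OF that]] hg[OF that] by simp
    then have "compose ?Z (\<pi> j) (compose ?Z g u) = compose ?Z (\<rho> j) u"
      using uX by (auto simp: compose_def fun_eq_iff)
    then show "compose ?Z (\<pi> j) (compose ?Z g u) = \<sigma> j" using \<rho>u j by simp
  next
    fix k assume k: "k \<in> dmaps Z L \<and> (\<forall>j\<in>Ob J. compose ?Z (\<pi> j) k = \<sigma> j)"
    have kL: "k z \<in> topspace (dtop L)" if "z \<in> ?Z" for z
      using dmaps_in_topspace[OF conjunct1[OF k] that] .
    have "compose ?Z (\<rho> j) (compose ?Z h k) = compose ?Z (\<pi> j) k" if "j \<in> Ob J" for j
      using \<rho>h'[OF that] kL by (auto simp: compose_def fun_eq_iff)
    \<comment> \<open>A competitor \<open>k\<close> pushed to \<open>X\<close> mediates the same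
      cone, so it becomes \<open>u\<close>; applying \<open>g\<close> recovers
      \<open>k\<close>.\<close>
    then have "compose ?Z h k = u"
      using k by (intro uniq dmaps_compose[OF Zp _ h]) auto
    then have "g (u z) = k z" if "z \<in> ?Z" for z
      using gh kL that by (metis compose_eq)
    then show "k = compose ?Z g u"
      using k by (intro extensionalityI[of _ ?Z]) (auto simp: compose_def dmaps_def)
  qed
qed

text \<open>The last conjunct frees the result from the chosen construction: an arbitrary limit
  \<open>L\<close> in \<open>DTop\<close> is isomorphic to the standard one, which transfers
  saturation and the universal property to \<open>L\<close>.\<close>

theorem proposition4p4:
  fixes J :: "('o, 'm) cat"
    and D :: "'o \<Rightarrow> 'a dspace"
    and Dm :: "'m \<Rightarrow> 'a \<Rightarrow> 'a"
  assumes "is_category J"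
    and "SDTop_diagram J D Dm"
  shows "DTop_limit TYPE('c) J D Dm (DTop_lim J D Dm) (DTop_lim_proj J D Dm)
       \<and> saturated (DTop_lim J D Dm)
       \<and> SDTop_limit TYPE('c) J D Dm (DTop_lim J D Dm) (DTop_lim_proj J D Dm)
       \<and> (\<forall>(L :: 'l dspace) \<pi>. DTop_limit TYPE('l) J D Dm L \<pi> \<longrightarrow>
            saturated L \<and> SDTop_limit TYPE('c) J D Dm L \<pi>)"
proof (intro conjI allI impI)
  let ?X = "DTop_lim J D Dm" and ?\<rho> = "DTop_lim_proj J D Dm"
  have diagram: "DTop_diagram J D Dm" using assms(2) by (simp add: SDTop_diagram_def)
  show limit: "DTop_limit TYPE('c) J D Dm ?X ?\<rho>"
    by (rule DTop_limit_DTop_lim[OF assms(1) diagram])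
  show sat: "saturated ?X" by (rule saturated_DTop_lim[OF assms(2)])
  show "SDTop_limit TYPE('c) J D Dm ?X ?\<rho>" by (rule SDTop_limit_if_DTop_limit[OF limit sat])
  fix L :: "'l dspace" and \<pi> assume L: "DTop_limit TYPE('l) J D Dm L \<pi>"
  obtain h g where iso: "h \<in> dmaps L ?X" "g \<in> dmaps ?X L"
    "\<And>l. l \<in> topspace (dtop L) \<Longrightarrow> g (h l) = l" "\<And>x. x \<in> topspace (dtop ?X) \<Longrightarrow> h (g x) = x"
    "\<And>j. j \<in> Ob J \<Longrightarrow> compose (topspace (dtop L)) (?\<rho> j) h = \<pi> j"
    using DTop_limit_isomorphic[OF L DTop_limit_DTop_lim[OF assms(1) diagram]
        universal_DTop_lim[OF _ assms(1)]] by blast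
  show satL: "saturated L"
    using saturated_isomorphic[OF _ sat iso(1,2)] iso(3) L by (simp add: DTop_limit_def)
  \<comment> \<open>The hypothesis on \<open>L\<close> speaks of test objects on \<open>'l\<close>;
    universality on \<open>'c\<close> is imported from the standard limit.\<close>
  have "universal_for (is_dspace :: 'c dspace \<Rightarrow> bool) J D Dm L \<pi>"
    by (rule universal_for_isomorphic[OF universal_DTop_lim[OF _ assms(1)] _ iso(1,2)])
       (simp_all add: iso(3-5))
  then show "SDTop_limit TYPE('c) J D Dm L \<pi>"
    using L satL by (intro SDTop_limit_if_DTop_limit) (auto simp: DTop_limit_def)
qed

end
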